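(* Let $\beta>0$. For two tokens at positions $(p_1,p_2)=(0,\Delta)$, $\Delta\in\mathbb{R}$, and one active frequency $\omega\in\mathbb{R}$, let $A$ be the $2\times2$ consensus attention matrix $A_{ij}=W_{ij}/\sum_kW_{ik}$ with $W_{ij}=\exp\bigl(\beta\cos(\omega(p_i-p_j))\bigr)$, and let $\gamma_\omega(\Delta)=1-\lambda_2(A)$. Then $$\gamma_\omega(\Delta)=\frac{2q}{1+q},\qquad q=\exp\bigl(\beta[\cos(\omega\Delta)-1]\bigr).$$ Take $\omega_{\rm low}=\pi/2$ and $\omega_{\rm high}=\pi$. At $\Delta=1$, the high frequency is slower: $\gamma_{\omega_{\rm high}}(1)<\gamma_{\omega_{\rm low}}(1)$. At $\Delta=2$, the high frequency is completely aliased, with $\gamma_{\omega_{\rm high}}(2)=1$, while $\gamma_{\omega_{\rm low}}(2)<1$. Hence there is no position-independent ordering of the gaps by frequency magnitude.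
   Context: $\lambda_2(A)$ denotes the second largest eigenvalue (with multiplicity) of $A$, whose eigenvalues are real. $A$ is the attention matrix at a consensus state of rotary self-attention all of whose energy lies in a rotation plane with frequency $\omega$; $\gamma$ is the local consensus rate (spectral gap). *)

theory Defs
  imports Complex_Main "HOL-Library.Multiset" "Jordan_Normal_Form.Char_Poly"
begin

(* Eigenvalues are the roots of the characteristic polynomial, counted with algebraic
   multiplicity.  Only real roots are listed, so this is meant for square matrices of
   dimension at least 2 whose eigenvalues are all real. *)
definition eigenvalues_desc :: "real mat \<Rightarrow> real list" where
  "eigenvalues_desc A = rev (sorted_list_of_multiset (proots (char_poly A)))"

definition lambda2 :: "real mat \<Rightarrow> real" where
  "lambda2 A = eigenvalues_desc A ! 1"

definition attn_weight :: "real \<Rightarrow> real \<Rightarrow> real list \<Rightarrow> nat \<Rightarrow> nat \<Rightarrow> real" where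
  "attn_weight \<beta> \<omega> p i j = exp (\<beta> * cos (\<omega> * (p ! i - p ! j)))"

(* The list p holds the token positions; rows and columns are indexed from 0. *)
definition attn_matrix :: "real \<Rightarrow> real \<Rightarrow> real list \<Rightarrow> real mat" where
  "attn_matrix \<beta> \<omega> p = mat (length p) (length p)
     (\<lambda>(i, j). attn_weight \<beta> \<omega> p i j / (\<Sum>k<length p. attn_weight \<beta> \<omega> p i k))"

definition consensus_gap :: "real \<Rightarrow> real \<Rightarrow> real \<Rightarrow> real" where
  "consensus_gap \<beta> \<omega> \<Delta> = 1 - lambda2 (attn_matrix \<beta> \<omega> [0, \<Delta>])"

end

theory Submission
  imports Defs
begin

text \<open>
  The cosine is even, so each of the two tokens weighs the other as much as it is weighed by it,
  and each weighs itself by \<open>exp \<beta>\<close>: the consensus attention matrix has one value \<open>a\<close> on the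
  diagonal and one value \<open>b\<close> off it. Such a matrix is diagonalised by the common mode \<open>(1, 1)\<close>,
  with eigenvalue \<open>a + b\<close>, and the disagreement mode \<open>(1, -1)\<close>, with eigenvalue \<open>a - b\<close>. After
  division by \<open>exp \<beta>\<close> the weights are \<open>1\<close> and \<open>q\<close>, so \<open>a = 1 / (1 + q)\<close> and
  \<open>b = q / (1 + q)\<close>. Since \<open>b\<close> is positive, the disagreement eigenvalue is the second largest,
  and the gap is \<open>1 - (a - b) = 2 * q / (1 + q)\<close> (lemma \<open>consensus_gap_eq\<close>).

  For fixed positive \<open>\<beta>\<close> the gap is thus a strictly increasing function of \<open>cos (\<omega> * \<Delta>)\<close>, which reduces every
  comparison of gaps to a comparison of cosines (lemma \<open>consensus_gap_less_iff\<close>). The pairs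
  \<open>cos \<pi> < cos (\<pi> / 2)\<close> at \<open>\<Delta> = 1\<close> and \<open>cos (2 \<pi>) > cos \<pi>\<close> at \<open>\<Delta> = 2\<close> order the frequencies
  \<open>\<pi> / 2\<close> and \<open>\<pi>\<close> in opposite ways, so no ordering by magnitude holds at all positions.
\<close>

text \<open>The change of basis to the eigenvectors \<open>(1, 1)\<close> and \<open>(1, -1)\<close> diagonalises the matrix.\<close>

lemma char_poly_circulant2:
  fixes a b :: real
  shows "char_poly (mat 2 2 (\<lambda>(i, j). if i = j then a else b)) = [:- (a + b), 1:] * [:- (a - b), 1:]"
proof -
  define A where "A = mat 2 2 (\<lambda>(i, j). if i = j then a else b)"
  define D where "D = mat 2 2 (\<lambda>(i, j). if i = j then if i = 0 then a + b else a - b else 0)"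
  define P where "P = mat 2 2 (\<lambda>(i, j). if i = 1 \<and> j = 1 then - 1 else 1 :: real)"
  define Q where "Q = mat 2 2 (\<lambda>(i, j). if i = 1 \<and> j = 1 then - 1 / 2 else 1 / 2 :: real)"
  note defs = A_def D_def P_def Q_def
  have ivl: "{0..<2::nat} = {0, 1}" and two: "\<And>i::nat. i < 2 \<longleftrightarrow> i = 0 \<or> i = 1" by auto
  have carrier: "{A, D, P, Q} \<subseteq> carrier_mat 2 2" by (simp add: defs)
  have "similar_mat A D"
  proof (rule similar_matI[OF carrier])
    show "P * Q = 1\<^sub>m 2" "Q * P = 1\<^sub>m 2" "A = P * D * Q"
      by (rule eq_matI; auto simp: defs scalar_prod_def ivl two field_simps)+
  qed
  then have "char_poly A = char_poly D" by (rule char_poly_similar)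
  also have "\<dots> = (\<Prod>x\<leftarrow>diag_mat D. [:- x, 1:])"
    by (rule char_poly_upper_triangular[of _ 2]) (auto simp: D_def upper_triangular_def)
  also have "diag_mat D = [a + b, a - b]"
    by (simp add: D_def diag_mat_def upt_rec)
  finally show ?thesis by (simp add: A_def)
qed

text \<open>The sign of \<open>b\<close> decides which of the two modes has the smaller eigenvalue.\<close>

lemma lambda2_circulant2:
  fixes a b :: real
  assumes "b \<ge> 0"
  shows "lambda2 (mat 2 2 (\<lambda>(i, j). if i = j then a else b)) = a - b"
proof -
  have "proots (char_poly (mat 2 2 (\<lambda>(i, j). if i = j then a else b))) = {#a - b, a + b#}"
    unfolding char_poly_circulant2 by (subst proots_mult) (auto simp: proots_linear_factor)
  also have "sorted_list_of_multiset \<dots> = [a - b, a + b]"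
    using assms by (simp add: add_mset_commute)
  finally show ?thesis by (simp add: lambda2_def eigenvalues_desc_def)
qed

text \<open>The factor \<open>exp \<beta>\<close>, common to all four weights, cancels in the row normalisation.\<close>

lemma attn_matrix_two_tokens:
  fixes \<beta> \<omega> \<Delta> :: real
  defines "q \<equiv> exp (\<beta> * (cos (\<omega> * \<Delta>) - 1))"
  shows "attn_matrix \<beta> \<omega> [0, \<Delta>] =
    mat 2 2 (\<lambda>(i, j). if i = j then 1 / (1 + q) else q / (1 + q))"
proof -
  have two: "\<And>i::nat. i < 2 \<longleftrightarrow> i = 0 \<or> i = 1" by auto
  have weight: "attn_weight \<beta> \<omega> [0, \<Delta>] i j = exp \<beta> * (if i = j then 1 else q)"
    if "i < 2" "j < 2" for i j
    using that by (auto simp: attn_weight_def two q_def exp_add[symmetric] algebra_simps)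
  have row: "(\<Sum>k<2. attn_weight \<beta> \<omega> [0, \<Delta>] i k) = exp \<beta> * (1 + q)" if "i < 2" for i
    using that weight by (auto simp: lessThan_nat_numeral two algebra_simps numeral_2_eq_2)
  show ?thesis
  proof (rule eq_matI)
    fix i j :: nat
    assume "i < dim_row (mat 2 2 (\<lambda>(i, j). if i = j then 1 / (1 + q) else q / (1 + q)))"
      "j < dim_col (mat 2 2 (\<lambda>(i, j). if i = j then 1 / (1 + q) else q / (1 + q)))"
    then have ij: "i < 2" "j < 2" by simp_all
    have len: "length [0, \<Delta>] = 2" by simp
    show "attn_matrix \<beta> \<omega> [0, \<Delta>] $$ (i, j) =
        mat 2 2 (\<lambda>(i, j). if i = j then 1 / (1 + q) else q / (1 + q)) $$ (i, j)"
      unfolding attn_matrix_def len index_mat(1)[OF ij] prod.case weight[OF ij] row[OF ij(1)]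
      by simp
  qed (simp_all add: attn_matrix_def)
qed

lemma consensus_gap_eq:
  fixes \<beta> \<omega> \<Delta> :: real
  defines "q \<equiv> exp (\<beta> * (cos (\<omega> * \<Delta>) - 1))"
  shows "consensus_gap \<beta> \<omega> \<Delta> = 2 * q / (1 + q)"
proof -
  have "q > 0" by (simp add: q_def)
  then have "consensus_gap \<beta> \<omega> \<Delta> = 1 - (1 / (1 + q) - q / (1 + q))"
    unfolding consensus_gap_def attn_matrix_two_tokens q_def[symmetric]
    by (subst lambda2_circulant2) auto
  also have "\<dots> = 2 * q / (1 + q)" using \<open>q > 0\<close> by (simp add: field_simps)
  finally show ?thesis .
qed

text \<open>Both \<open>x \<mapsto> 2 x / (1 + x)\<close> on the positive reals and the exponential are strictly increasing.\<close>

lemma consensus_gap_less_iff: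
  assumes "\<beta> > 0"
  shows "consensus_gap \<beta> \<omega> \<Delta> < consensus_gap \<beta> \<omega>' \<Delta>' \<longleftrightarrow> cos (\<omega> * \<Delta>) < cos (\<omega>' * \<Delta>')"
proof -
  have mono: "2 * x / (1 + x) < 2 * y / (1 + y) \<longleftrightarrow> x < y" if "x > 0" "y > 0" for x y :: real
    using that by (simp add: field_simps)
  show ?thesis
    using assms by (simp add: consensus_gap_eq mono)
qed

theorem proposition7p5:
  fixes \<beta> :: real
  assumes "\<beta> > 0"
  shows "(\<forall>\<omega> \<Delta>. let q = exp (\<beta> * (cos (\<omega> * \<Delta>) - 1))
                 in consensus_gap \<beta> \<omega> \<Delta> = 2 * q / (1 + q)) \<and>
    (let \<omega>\<^sub>l\<^sub>o\<^sub>w = pi / 2; \<omega>\<^sub>h\<^sub>i\<^sub>g\<^sub>h = pi in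
       consensus_gap \<beta> \<omega>\<^sub>h\<^sub>i\<^sub>g\<^sub>h 1 < consensus_gap \<beta> \<omega>\<^sub>l\<^sub>o\<^sub>w 1 \<and>
       attn_matrix \<beta> \<omega>\<^sub>h\<^sub>i\<^sub>g\<^sub>h [0, 2] = attn_matrix \<beta> \<omega>\<^sub>h\<^sub>i\<^sub>g\<^sub>h [0, 0] \<and>
       consensus_gap \<beta> \<omega>\<^sub>h\<^sub>i\<^sub>g\<^sub>h 2 = 1 \<and>
       consensus_gap \<beta> \<omega>\<^sub>l\<^sub>o\<^sub>w 2 < 1) \<and>
    \<not> (\<forall>\<omega> \<omega>'. \<bar>\<omega>\<bar> < \<bar>\<omega>'\<bar> \<longrightarrow>
         (\<forall>\<Delta>. consensus_gap \<beta> \<omega> \<Delta> \<le> consensus_gap \<beta> \<omega>' \<Delta>) \<or>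
         (\<forall>\<Delta>. consensus_gap \<beta> \<omega>' \<Delta> \<le> consensus_gap \<beta> \<omega> \<Delta>))"
proof -
  have high_slower: "consensus_gap \<beta> pi 1 < consensus_gap \<beta> (pi / 2) 1"
    using assms by (simp add: consensus_gap_less_iff)
  have low_slower: "consensus_gap \<beta> (pi / 2) 2 < consensus_gap \<beta> pi 2"
    using assms by (simp add: consensus_gap_less_iff mult.commute[of pi])
  have high_full: "consensus_gap \<beta> pi 2 = 1"
    by (simp add: consensus_gap_eq mult.commute[of pi])
  have aliased: "attn_matrix \<beta> pi [0, 2] = attn_matrix \<beta> pi [0, 0]"
    unfolding attn_matrix_two_tokens by (simp only: mult.commute[of pi] cos_two_pi mult_zero_left cos_zero)
  have "\<bar>pi / 2\<bar> < \<bar>pi\<bar>" by simp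
  then have "\<not> (\<forall>\<omega> \<omega>'. \<bar>\<omega>\<bar> < \<bar>\<omega>'\<bar> \<longrightarrow>
         (\<forall>\<Delta>. consensus_gap \<beta> \<omega> \<Delta> \<le> consensus_gap \<beta> \<omega>' \<Delta>) \<or>
         (\<forall>\<Delta>. consensus_gap \<beta> \<omega>' \<Delta> \<le> consensus_gap \<beta> \<omega> \<Delta>))"
    using high_slower low_slower by (meson not_le)
  then show ?thesis
    using high_slower low_slower high_full aliased by (simp add: Let_def consensus_gap_eq)
qed

end
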